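(* Consider the fluid model described in the context, with regions $\mathcal N=\{1,\dots,N\}$ and fleet size $m$. Let $\mathbf u$ be a price vector such that $\sum_j\big(\lambda_{ij}(u_{ij})-\lambda_{ji}(u_{ji})\big)=0$ for all $i\in\mathcal N$, let $m_{\mathbf u}:=\sum_{i,j}T_{ij}\lambda_{ij}(u_{ij})$, and assume $m>m_{\mathbf u}$. Then the set of equilibria $$\Upsilon_{\mathbf u}:=\Big\{(\mathbf c,\mathbf v)\in\mathbb R^{2N}\ :\ c_i=0,\ v_i>0\ \ \forall i\in\mathcal N,\ \text{ and }\ \sum_iv_i=m-m_{\mathbf u}\Big\}$$ is locally asymptotically stable, in the following sense: for any equilibrium $(\underline{\mathbf c},\underline{\mathbf v})\in\Upsilon_{\mathbf u}$ there exists a neighborhood $\mathcal B_{\mathbf u}^\delta(\underline{\mathbf c},\underline{\mathbf v})$ (for some $\delta>0$) such that every evolution of the model with $(\mathbf c(\tau),\mathbf v(\tau))=(\underline{\mathbf c},\underline{\mathbf v})$ for $\tau\in[-\max_{i,j}T_{ij},0)$ and with $(\mathbf c(0),\mathbf v(0))\in\mathcal B_{\mathbf u}^\delta(\underline{\mathbf c},\underline{\mathbf v})$ has a limit which belongs to the equilibrium set, i.e. $\big(\lim_{t\to+\infty}\mathbf c(t),\lim_{t\to+\infty}\mathbf v(t)\big)\in\Upsilon_{\mathbf u}$, where $$\mathcal B_{\mathbf u}^\delta(\underline{\mathbf c},\underline{\mathbf v}):=\big\{(\mathbf c,\mathbf v)\in\mathbb R^{2N}\ :\ c_i>0,\ v_i=\underline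 v_i\ \ \forall i\in\mathcal N,\ \text{ and }\ \|(\mathbf c-\underline{\mathbf c},0)\|<\delta\big\}.$$
   Context: $\mathcal N=\{1,\dots,N\}$ is the set of regions; all sums over $i,j$ run over $\mathcal N$. For each pair $(i,j)$ there is a fixed travel time $T_{ij}\in\mathbb R_{\ge0}$ and a demand function $\lambda_{ij}:\mathbb R_{\ge0}\to\mathbb R_{\ge0}$ of the surge price $u_{ij}$, giving the arrival rate of customers travelling from $i$ to $j$. Each $\lambda_{ij}$ is monotonically decreasing, and there is a surge price $u_{ij}^{\max}$ with $\lambda_{ij}(u_{ij}^{\max})=0$. A price vector is $\mathbf u=(u_{ij})$ with $u_{ij}\in[1,u_{ij}^{\max}]$. Put $\lambda_{ij}^0=\lambda_{ij}(1)$. The service rates $\mu_i$ satisfy $\mu_i>\sum_j\lambda^0_{ij}$ for all $i$. For fixed prices write $\lambda_{ij}=\lambda_{ij}(u_{ij})$ and $\lambda_i=\sum_j\lambda_{ij}$. Let $H(x)=1$ if $x>0$ and $H(x)=0$ otherwise. The state consists of $c_i(t)\ge0$ (customers waiting in region $i$) and $v_i(t)\ge0$ (vehicles available in region $i$). With $v_j^i:=v_j(t-T_{ji})$ and $c_j^i:=c_j(t-T_{ji})$, the dynamics are $$\dot c_i=\lambda_i(1-H(v_i))+(\lambda_i-\mu_i)H(c_i)H(v_i),$$ $$\dot v_i=-\lambda_iH(v_i)+(\lambda_i-\mu_i)H(c_i)H(v_i)+\sum_j\Big(\lambda_{ji}H(v_j^i)-(\lambda_{ji}-\mu_j)H(c_j^i)H(v_j^i)\Big).$$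 This is a time-delayed system with discontinuous right-hand side; its evolutions are the solutions in the sense of Filippov, with $c_i,v_i$ continuous and nonnegative on $[0,\infty)$ and the prescribed values on $[-\max_{i,j}T_{ij},0)$ and at time $0$. The fleet size $m$ is the total number of vehicles, waiting in regions or in transit; $m_{\mathbf u}$ is the number in transit in a constant state with $\mathbf c=0$, $\mathbf v>0$. $\|\cdot\|$ is a norm on $\mathbb R^{2N}$ (e.g. Euclidean).
   Formalization: In the arrival term of the vehicle dynamics, μ_j is replaced by p_ji μ_j with p_ji = λ_ji/λ_j (any fixed destination shares if λ_j = 0); as printed, vehicles are created for N ≥ 2 and the claim fails; for N = 1 nothing changes. *)

theory Defs
  imports "HOL-Analysis.Analysis"
begin

text \<open>Regions are the elements of a finite type \<open>'n\<close>; a state is a pair \<open>(c, v)\<close> of waiting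
  customers and available vehicles, i.e. a point of \<open>R^(2N)\<close>.\<close>

type_synonym 'n state = "(real ^ 'n) \<times> (real ^ 'n)"

definition heaviside :: "real \<Rightarrow> real" where
  "heaviside x = (if x > 0 then 1 else 0)"

text \<open>\<open>r i j\<close> is the constant arrival rate of customers from \<open>i\<close> to \<open>j\<close> at the chosen prices.\<close>

definition out_rate :: "('n::finite \<Rightarrow> 'n \<Rightarrow> real) \<Rightarrow> 'n \<Rightarrow> real" where
  "out_rate r i = (\<Sum>j\<in>UNIV. r i j)"

text \<open>\<open>p i j\<close> is the fraction of the customers of region \<open>i\<close> that travel to \<open>j\<close>. It is determined by the
  rates unless \<open>out_rate r i = 0\<close>, where the quotient \<open>r i j / out_rate r i\<close> says nothing about the
  destinations of the customers that are already waiting.\<close>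

definition destination_shares :: "('n::finite \<Rightarrow> 'n \<Rightarrow> real) \<Rightarrow> ('n \<Rightarrow> 'n \<Rightarrow> real) \<Rightarrow> bool" where
  "destination_shares r p \<longleftrightarrow>
     (\<forall>i j. 0 \<le> p i j) \<and> (\<forall>i. (\<Sum>j\<in>UNIV. p i j) = 1) \<and> (\<forall>i j. r i j = p i j * out_rate r i)"

text \<open>The delayed state \<open>x (t - T j i)\<close>. For zero travel time it is the current state \<open>y\<close>, on which the
  right-hand side then depends discontinuously; for positive travel time it is a known function of
  time.\<close>

definition delayed :: "('n \<Rightarrow> 'n \<Rightarrow> real) \<Rightarrow> (real \<Rightarrow> 'n state) \<Rightarrow> real \<Rightarrow> 'n state \<Rightarrow> 'n \<Rightarrow> 'n \<Rightarrow> 'n state" where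
  "delayed T x t y j i = (if T j i = 0 then y else x (t - T j i))"

definition customer_rate :: "('n::finite \<Rightarrow> 'n \<Rightarrow> real) \<Rightarrow> ('n \<Rightarrow> real) \<Rightarrow> 'n state \<Rightarrow> 'n \<Rightarrow> real" where
  "customer_rate r mu y i =
     out_rate r i * (1 - heaviside (snd y $ i))
     + (out_rate r i - mu i) * heaviside (fst y $ i) * heaviside (snd y $ i)"

text \<open>Rate at which vehicles reach \<open>i\<close> from \<open>j\<close>, where \<open>z\<close> is the state at their departure. Vehicles leave
  \<open>j\<close> at total rate \<open>out_rate r j\<close> if no customers are waiting there and at total rate \<open>mu j\<close>
  otherwise; in both cases the fraction \<open>p j i\<close> of them heads for \<open>i\<close>, so that no vehicle is created
  or lost.\<close>

definition arrival_rate ::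
  "('n::finite \<Rightarrow> 'n \<Rightarrow> real) \<Rightarrow> ('n \<Rightarrow> real) \<Rightarrow> ('n \<Rightarrow> 'n \<Rightarrow> real) \<Rightarrow> 'n state \<Rightarrow> 'n \<Rightarrow> 'n \<Rightarrow> real" where
  "arrival_rate r mu p z j i =
     r j i * heaviside (snd z $ j)
     - (r j i - p j i * mu j) * heaviside (fst z $ j) * heaviside (snd z $ j)"

definition vehicle_rate ::
  "('n::finite \<Rightarrow> 'n \<Rightarrow> real) \<Rightarrow> ('n \<Rightarrow> real) \<Rightarrow> ('n \<Rightarrow> 'n \<Rightarrow> real) \<Rightarrow> ('n \<Rightarrow> 'n \<Rightarrow> real) \<Rightarrow>
   (real \<Rightarrow> 'n state) \<Rightarrow> real \<Rightarrow> 'n state \<Rightarrow> 'n \<Rightarrow> real" where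
  "vehicle_rate r mu p T x t y i =
     - out_rate r i * heaviside (snd y $ i)
     + (out_rate r i - mu i) * heaviside (fst y $ i) * heaviside (snd y $ i)
     + (\<Sum>j\<in>UNIV. arrival_rate r mu p (delayed T x t y j i) j i)"

definition fluid_field ::
  "('n::finite \<Rightarrow> 'n \<Rightarrow> real) \<Rightarrow> ('n \<Rightarrow> real) \<Rightarrow> ('n \<Rightarrow> 'n \<Rightarrow> real) \<Rightarrow> ('n \<Rightarrow> 'n \<Rightarrow> real) \<Rightarrow>
   (real \<Rightarrow> 'n state) \<Rightarrow> real \<Rightarrow> 'n state \<Rightarrow> 'n state" where
  "fluid_field r mu p T x t y =
     ((\<chi> i. customer_rate r mu y i), (\<chi> i. vehicle_rate r mu p T x t y i))"

definition filippov_set :: "('a::euclidean_space \<Rightarrow> 'a) \<Rightarrow> 'a \<Rightarrow> 'a set" where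
  "filippov_set f y =
     (\<Inter>d\<in>{0<..}. \<Inter>S\<in>{S. negligible S}. closure (convex hull (f ` (ball y d - S))))"

text \<open>Filippov solutions on \<open>[0, \<infinity>)\<close>: locally absolutely continuous functions, i.e. indefinite integrals
  of a locally Lebesgue integrable \<open>w\<close>, whose derivative \<open>w\<close> lies almost everywhere in the
  Filippov set of the field.\<close>

definition filippov_solution :: "(real \<Rightarrow> 'a::euclidean_space \<Rightarrow> 'a) \<Rightarrow> (real \<Rightarrow> 'a) \<Rightarrow> bool" where
  "filippov_solution F x \<longleftrightarrow>
     (\<exists>w. (\<forall>t\<ge>0. w absolutely_integrable_on {0..t} \<and> x t = x 0 + integral {0..t} w) \<and>
          (AE t in lebesgue. 0 \<le> t \<longrightarrow> w t \<in> filippov_set (F t) (x t)))"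

text \<open>The function \<open>x\<close> is defined on all of \<open>R\<close>; its values on \<open>[- max T, 0)\<close> are the initial history,
  which need not fit continuously to \<open>x 0\<close>.\<close>

definition evolution ::
  "('n::finite \<Rightarrow> 'n \<Rightarrow> real) \<Rightarrow> ('n \<Rightarrow> real) \<Rightarrow> ('n \<Rightarrow> 'n \<Rightarrow> real) \<Rightarrow> ('n \<Rightarrow> 'n \<Rightarrow> real) \<Rightarrow>
   (real \<Rightarrow> 'n state) \<Rightarrow> bool" where
  "evolution r mu p T x \<longleftrightarrow>
     continuous_on {0..} x \<and>
     (\<forall>t\<ge>0. \<forall>i. 0 \<le> fst (x t) $ i \<and> 0 \<le> snd (x t) $ i) \<and>
     filippov_solution (fluid_field r mu p T x) x"

definition max_delay :: "('n::finite \<Rightarrow> 'n \<Rightarrow> real) \<Rightarrow> real" where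
  "max_delay T = Max (range (\<lambda>(i, j). T i j))"

definition in_transit :: "('n::finite \<Rightarrow> 'n \<Rightarrow> real) \<Rightarrow> ('n \<Rightarrow> 'n \<Rightarrow> real) \<Rightarrow> real" where
  "in_transit T r = (\<Sum>i\<in>UNIV. \<Sum>j\<in>UNIV. T i j * r i j)"

definition equilibria :: "('n::finite \<Rightarrow> 'n \<Rightarrow> real) \<Rightarrow> ('n \<Rightarrow> 'n \<Rightarrow> real) \<Rightarrow> real \<Rightarrow> 'n state set" where
  "equilibria T r m =
     {(c, v). (\<forall>i. c $ i = 0 \<and> v $ i > 0) \<and> (\<Sum>i\<in>UNIV. v $ i) = m - in_transit T r}"

definition is_norm :: "('a::real_vector \<Rightarrow> real) \<Rightarrow> bool" where
  "is_norm nrm \<longleftrightarrow>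
     (\<forall>x. nrm x = 0 \<longleftrightarrow> x = 0) \<and> (\<forall>x y. nrm (x + y) \<le> nrm x + nrm y) \<and>
     (\<forall>a x. nrm (a *\<^sub>R x) = \<bar>a\<bar> * nrm x)"

definition perturbations :: "('n::finite state \<Rightarrow> real) \<Rightarrow> real \<Rightarrow> 'n state \<Rightarrow> 'n state set" where
  "perturbations nrm d e =
     {(c, v). (\<forall>i. c $ i > 0 \<and> v $ i = snd e $ i) \<and> nrm (c - fst e, 0) < d}"

end

theory Submission
  imports Defs
begin

text \<open>As long as all \<open>v\<^sub>i\<close> are positive, every vector of the Filippov set obeys the linear relation
  \<open>v\<^sub>i' = c\<^sub>i' - \<Sum>\<^sub>j p\<^sub>j\<^sub>i c\<^sub>j'(t - T\<^sub>j\<^sub>i)\<close> (the balance condition cancels the constant rates), and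
  \<open>c\<^sub>i\<close> falls at the constant speed \<open>\<mu>\<^sub>i - \<lambda>\<^sub>i\<close> until it reaches zero and stays there. Integrating,
  \<open>v\<^sub>i(t) = v\<^sub>i(0) - q\<^sub>i(t) + \<Sum>\<^sub>j p\<^sub>j\<^sub>i q\<^sub>j(t - T\<^sub>j\<^sub>i)\<close>, where \<open>q\<^sub>i = min (c\<^sub>i(0)) ((\<mu>\<^sub>i - \<lambda>\<^sub>i) t\<^sup>+)\<close> is the
  part of the initial queue served so far. Hence \<open>v\<^sub>i \<ge> v\<^sub>i(0) - c\<^sub>i(0)\<close>, so for a small initial queue
  no \<open>v\<^sub>i\<close> ever vanishes, the formulas hold for all times, and the state is constant after a finite
  time. Its total number of vehicles is the initial one because \<open>\<Sum>\<^sub>i p\<^sub>j\<^sub>i = 1\<close>.\<close>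

section \<open>Linear constraints satisfied by the Filippov set of the fluid field\<close>

text \<open>The preimage of \<open>S\<close> under \<open>g\<close> is closed and convex, so it
  contains the closed convex hull of the field values on the ball; the exceptional null set can be
  taken empty. An interval \<open>S\<close> transfers bounds to the Filippov set, a singleton
  \<open>S\<close> transfers linear equations.\<close>

lemma filippov_set_linear_image:
  fixes g :: "'a::euclidean_space \<Rightarrow> real"
  assumes "linear g" "closed S" "convex S" "d > 0" "w \<in> filippov_set f y"
    and "\<And>z. z \<in> ball y d \<Longrightarrow> g (f z) \<in> S"
  shows "g w \<in> S"
proof -
  have "w \<in> closure (convex hull (f ` (ball y d - {})))"
    using assms(4,5) unfolding filippov_set_def by (metis INT_E greaterThan_iff mem_Collect_eq negligible_empty)
  moreover have "closure (convex hull (f ` (ball y d - {}))) \<subseteq> g -` S"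
  proof (intro closure_minimal hull_minimal)
    show "f ` (ball y d - {}) \<subseteq> g -` S" using assms(6) by auto
    show "convex (g -` S)" using assms by (intro convex_linear_vimage)
    have "continuous_on UNIV g"
      using assms(1) by (intro linear_continuous_on) (simp add: linear_conv_bounded_linear)
    then show "closed (g -` S)" using assms(2) by (intro closed_vimage)
  qed
  ultimately show ?thesis by auto
qed

text \<open>On such a ball the Heaviside factors of all vehicle counts and of all nonempty queues
  equal 1; only the factors of queues empty at \<open>y\<close> can still jump.\<close>

lemma component_pos_in_ball:
  fixes y :: "'n::finite state"
  assumes "\<And>i. snd y $ i > 0"
  obtains d where "d > 0" "\<And>z i. z \<in> ball y d \<Longrightarrow> snd z $ i > 0"
    "\<And>z i. z \<in> ball y d \<Longrightarrow> fst y $ i > 0 \<Longrightarrow> fst z $ i > 0"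
proof -
  let ?S = "(\<Inter>i. {z :: 'n state. snd z $ i > 0}) \<inter> (\<Inter>i\<in>{i. fst y $ i > 0}. {z. fst z $ i > 0})"
  have "open ?S"
    by (intro open_Int open_INT finite_UNIV) (auto intro!: open_Collect_less continuous_intros)
  moreover have "y \<in> ?S" using assms by auto
  ultimately obtain d where "d > 0" "ball y d \<subseteq> ?S" by (meson openE)
  then show ?thesis by (intro that[of d]) blast+
qed

context
  fixes r p T :: "'n::finite \<Rightarrow> 'n \<Rightarrow> real" and mu :: "'n \<Rightarrow> real"
  assumes shares: "destination_shares r p"
    and service: "\<And>i. out_rate r i < mu i"
begin

lemma share_nonneg: "0 \<le> p j i"
  using shares by (simp add: destination_shares_def)

lemma share_sum: "(\<Sum>i\<in>UNIV. p j i) = 1"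
  using shares by (simp add: destination_shares_def)

lemma arrival_rate_eq:
  assumes "snd z $ j > 0"
  shows "arrival_rate r mu p z j i = r j i + p j i * ((mu j - out_rate r j) * heaviside (fst z $ j))"
proof -
  have "r j i = p j i * out_rate r j" using shares by (simp add: destination_shares_def)
  then show ?thesis using assms by (simp add: arrival_rate_def heaviside_def algebra_simps)
qed

text \<open>Near \<open>y\<close> the field jumps only through the Heaviside factors of the queues.
  These enter the vehicle rates through the customer rates, so a suitable linear combination of
  components is constant near \<open>y\<close> and keeps its value on the Filippov set. With zero
  travel time the arrivals jump with the current state and must be expressed by
  \<open>fst w\<close>; with positive travel time they are a fixed number.\<close>

lemma filippov_fluid_field:
  fixes i :: 'n
  assumes w: "w \<in> filippov_set (fluid_field r mu p T x t) y" and pos: "\<And>i. snd y $ i > 0"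
  shows "fst w $ i \<in> {- (mu i - out_rate r i)..0}"
    and "fst y $ i > 0 \<Longrightarrow> fst w $ i = - (mu i - out_rate r i)"
    and "snd w $ i = fst w $ i - out_rate r i +
           (\<Sum>j\<in>UNIV. if T j i = 0 then r j i - p j i * fst w $ j
                      else arrival_rate r mu p (x (t - T j i)) j i)"
proof -
  obtain d where d: "d > 0" "\<And>z i. z \<in> ball y d \<Longrightarrow> snd z $ i > 0"
    "\<And>z i. z \<in> ball y d \<Longrightarrow> fst y $ i > 0 \<Longrightarrow> fst z $ i > 0"
    using component_pos_in_ball[OF pos] by metis
  have fst_field: "fst (fluid_field r mu p T x t z) $ i = - (mu i - out_rate r i) * heaviside (fst z $ i)"
    if "z \<in> ball y d" for z i
    using d(2)[OF that] by (simp add: fluid_field_def customer_rate_def heaviside_def)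
  have lin: "linear (\<lambda>w :: 'n state. fst w $ i)"
    by (intro linearI) auto
  show "fst w $ i \<in> {- (mu i - out_rate r i)..0}"
  proof (rule filippov_set_linear_image[OF lin _ _ d(1) w])
    fix z assume "z \<in> ball y d"
    then show "fst (fluid_field r mu p T x t z) $ i \<in> {- (mu i - out_rate r i)..0}"
      using service[of i] by (simp add: fst_field heaviside_def)
  qed auto
  show "fst w $ i = - (mu i - out_rate r i)" if "fst y $ i > 0"
  proof -
    have "fst w $ i \<in> {- (mu i - out_rate r i)}"
    proof (rule filippov_set_linear_image[OF lin _ _ d(1) w])
      fix z assume "z \<in> ball y d"
      then show "fst (fluid_field r mu p T x t z) $ i \<in> {- (mu i - out_rate r i)}"
        using d(3) that by (simp add: fst_field heaviside_def)
    qed auto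
    then show ?thesis by simp
  qed
  \<comment> \<open>The coefficients of \<open>g\<close> are those with which the customer rates
    enter the vehicle rate of \<open>i\<close>, with opposite sign; hence all Heaviside factors of
    the current queues cancel and the constant \<open>b\<close> remains.\<close>
  define g :: "'n state \<Rightarrow> real" where
    "g w = snd w $ i - fst w $ i + (\<Sum>j\<in>UNIV. if T j i = 0 then p j i * fst w $ j else 0)" for w
  define b where "b = - out_rate r i +
    (\<Sum>j\<in>UNIV. if T j i = 0 then r j i else arrival_rate r mu p (x (t - T j i)) j i)"
  have "linear g"
    unfolding g_def
    by (intro linear_compose_add linear_compose_sub linear_compose_sum ballI) (auto intro!: linearI simp: algebra_simps)
  have "g w \<in> {b}"
  proof (rule filippov_set_linear_image[OF \<open>linear g\<close> _ _ d(1) w])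
    fix z assume z: "z \<in> ball y d"
    have "(\<Sum>j\<in>UNIV. arrival_rate r mu p (delayed T x t z j i) j i)
      + (\<Sum>j\<in>UNIV. if T j i = 0 then p j i * (- (mu j - out_rate r j) * heaviside (fst z $ j)) else 0)
      = (\<Sum>j\<in>UNIV. if T j i = 0 then r j i else arrival_rate r mu p (x (t - T j i)) j i)"
      unfolding sum.distrib[symmetric]
      using d(2)[OF z] by (intro sum.cong) (auto simp: delayed_def arrival_rate_eq algebra_simps)
    moreover have "vehicle_rate r mu p T x t z i = - out_rate r i
        + - (mu i - out_rate r i) * heaviside (fst z $ i)
        + (\<Sum>j\<in>UNIV. arrival_rate r mu p (delayed T x t z j i) j i)"
      using d(2)[OF z] by (simp add: vehicle_rate_def heaviside_def)
    moreover have "snd (fluid_field r mu p T x t z) $ i = vehicle_rate r mu p T x t z i"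
      by (simp add: fluid_field_def)
    ultimately show "g (fluid_field r mu p T x t z) \<in> {b}"
      unfolding g_def b_def by (simp add: fst_field[OF z] cong: if_cong)
  qed auto
  then have "snd w $ i = fst w $ i + b - (\<Sum>j\<in>UNIV. if T j i = 0 then p j i * fst w $ j else 0)"
    by (simp add: g_def)
  then show "snd w $ i = fst w $ i - out_rate r i +
           (\<Sum>j\<in>UNIV. if T j i = 0 then r j i - p j i * fst w $ j
                      else arrival_rate r mu p (x (t - T j i)) j i)"
    unfolding b_def by (simp add: sum_subtractf[symmetric]) (rule sum.cong, auto)
qed

end

section \<open>The served part of a queue as a function of time\<close>

text \<open>Clipping the time at 0 makes delayed arguments \<open>t - T j i\<close> meaningful
  before the first customers from \<open>j\<close> can have arrived.\<close>

definition served :: "real \<Rightarrow> real \<Rightarrow> real \<Rightarrow> real" where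
  "served q k t = min q (k * max 0 t)"

lemma served_bounds:
  assumes "0 \<le> q" "0 \<le> k"
  shows "0 \<le> served q k t" "served q k t \<le> q"
  using assms by (auto simp: served_def)

lemma served_nonpos: "0 \<le> q \<Longrightarrow> t \<le> 0 \<Longrightarrow> served q k t = 0"
  by (simp add: served_def max_absorb1)

lemma served_eventually:
  assumes "0 < k" "0 \<le> q" "q / k \<le> t"
  shows "served q k t = q"
proof -
  have "q \<le> t * k" using assms by (simp add: pos_divide_le_eq)
  also have "\<dots> \<le> k * max 0 t" using assms by (simp add: mult.commute mult_left_mono)
  finally show ?thesis by (simp add: served_def min_absorb1)
qed

lemma served_less_iff: "0 < k \<Longrightarrow> 0 \<le> t \<Longrightarrow> served q k t < q \<longleftrightarrow> t < q / k"
  by (simp add: served_def min_less_iff_disj pos_less_divide_eq mult.commute)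

text \<open>The shifted function is continuous and piecewise linear with kinks at \<open>a\<close>
  and \<open>a + q / k\<close>, so the fundamental theorem applies off these two points. Its value
  at time 0 vanishes because \<open>a\<close> is nonnegative.\<close>

lemma served_has_integral:
  assumes "0 < k" "0 < q" "0 \<le> a" "0 \<le> t"
  shows "((\<lambda>s. if 0 \<le> s - a \<and> s - a < q / k then k else 0) has_integral served q k (t - a)) {0..t}"
proof -
  have "((\<lambda>s. if 0 \<le> s - a \<and> s - a < q / k then k else 0) has_integral
      served q k (t - a) - served q k (0 - a)) {0..t}"
  proof (rule fundamental_theorem_of_calculus_interior_strong[where S = "{a, a + q / k}"])
    show "continuous_on {0..t} (\<lambda>s. served q k (s - a))"
      unfolding served_def by (intro continuous_intros)
    fix s assume s: "s \<in> {0<..<t} - {a, a + q / k}"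
    consider "s < a" | "a < s" "s < a + q / k" | "a + q / k < s" using s by force
    then show "((\<lambda>s. served q k (s - a)) has_vector_derivative
        (if 0 \<le> s - a \<and> s - a < q / k then k else 0)) (at s)"
    proof cases
      case 1
      have "((\<lambda>s. 0) has_vector_derivative 0) (at s)" by simp
      then have "((\<lambda>s. served q k (s - a)) has_vector_derivative 0) (at s)"
        by (rule has_vector_derivative_transform_within_open[of _ _ _ "{..<a}"])
           (use 1 assms in \<open>auto simp: served_nonpos\<close>)
      with 1 show ?thesis by simp
    next
      case 2
      have "((\<lambda>s. k * (s - a)) has_vector_derivative k) (at s)"
        by (auto intro!: derivative_eq_intros simp: has_real_derivative_iff_has_vector_derivative[symmetric])
      then have "((\<lambda>s. served q k (s - a)) has_vector_derivative k) (at s)"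
        by (rule has_vector_derivative_transform_within_open[of _ _ _ "{a<..<a + q / k}"])
           (use 2 assms in \<open>auto simp: served_def field_simps min_def max_def\<close>)
      with 2 show ?thesis by simp
    next
      case 3
      have "((\<lambda>s. q) has_vector_derivative 0) (at s)" by simp
      then have "((\<lambda>s. served q k (s - a)) has_vector_derivative 0) (at s)"
        by (rule has_vector_derivative_transform_within_open[of _ _ _ "{a + q / k<..}"])
           (use 3 assms in \<open>auto simp: served_eventually\<close>)
      with 3 show ?thesis by simp
    qed
  qed (use assms in auto)
  then show ?thesis using assms by (simp add: served_nonpos)
qed

section \<open>Decay of a queue whose derivative is known almost everywhere\<close>

lemma has_integral_le_off_negligible:
  fixes f :: "real \<Rightarrow> real"
  assumes f: "(f has_integral I) {a..b}" and "a \<le> b" and N: "negligible N"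
    and le: "\<And>t. t \<in> {a..b} - N \<Longrightarrow> f t \<le> B"
  shows "I \<le> B * (b - a)"
proof -
  have "((\<lambda>t. if t \<in> N then B else f t) has_integral I) {a..b}"
    by (rule has_integral_spike[OF N _ f]) auto
  moreover have "((\<lambda>t. B) has_integral B * (b - a)) {a..b}"
    using has_integral_const_real[of B a b] \<open>a \<le> b\<close> by (simp add: mult.commute)
  ultimately show ?thesis
    by (rule has_integral_le) (use le in auto)
qed

lemma has_integral_ge_off_negligible:
  fixes f :: "real \<Rightarrow> real"
  assumes "(f has_integral I) {a..b}" "a \<le> b" "negligible N"
    and "\<And>t. t \<in> {a..b} - N \<Longrightarrow> B \<le> f t"
  shows "B * (b - a) \<le> I"
proof -
  have "- I \<le> - B * (b - a)"
    using assms(4) by (intro has_integral_le_off_negligible[OF has_integral_neg[OF assms(1)] assms(2,3)]) simp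
  then show ?thesis by simp
qed

text \<open>The bound \<open>- k\<close> on the slope keeps the queue positive before time
  \<open>c 0 / k\<close>, which forces the slope to be exactly \<open>- k\<close> there. Afterwards
  the slope is nonpositive, and nonnegativity of \<open>c\<close> pins the queue at zero.\<close>

lemma queue_served:
  fixes c w :: "real \<Rightarrow> real"
  assumes k: "0 < k" and c0: "0 < c 0"
    and nonneg: "\<And>t. t \<in> {0..s} \<Longrightarrow> 0 \<le> c t"
    and int: "\<And>a b. 0 \<le> a \<Longrightarrow> a \<le> b \<Longrightarrow> b \<le> s \<Longrightarrow> (w has_integral c b - c a) {a..b}"
    and N: "negligible N"
    and bounds: "\<And>t. t \<in> {0..s} - N \<Longrightarrow> w t \<in> {- k..0}"
    and pos: "\<And>t. t \<in> {0..s} - N \<Longrightarrow> 0 < c t \<Longrightarrow> w t = - k"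
    and t: "t \<in> {0..s}"
  shows "c t = c 0 - served (c 0) k t"
proof -
  have lower: "c 0 - k * t \<le> c t" if "t \<in> {0..s}" for t
    using has_integral_ge_off_negligible[OF int[of 0 t] _ N, of "- k"] bounds that by force
  have upper: "c t \<le> c 0 - k * t" if "t \<in> {0..s}" "k * t \<le> c 0" for t
  proof -
    \<comment> \<open>The endpoint joins the null set because the queue may already be empty at
      \<open>t\<close> when \<open>k * t = c 0\<close>.\<close>
    have "w \<sigma> \<le> - k" if "\<sigma> \<in> {0..t} - (N \<union> {t})" for \<sigma>
    proof -
      have "k * \<sigma> < k * t" using that k by auto
      then have "0 < c \<sigma>" using lower[of \<sigma>] that \<open>t \<in> {0..s}\<close> \<open>k * t \<le> c 0\<close> by auto
      then show ?thesis using pos[of \<sigma>] that \<open>t \<in> {0..s}\<close> by auto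
    qed
    then show ?thesis
      using has_integral_le_off_negligible[OF int[of 0 t], of "N \<union> {t}" "- k"] N that by force
  qed
  show ?thesis
  proof (cases "k * t \<le> c 0")
    case True
    then show ?thesis using upper[of t] lower[of t] t by (simp add: served_def)
  next
    case False
    define \<tau> where "\<tau> = c 0 / k"
    have \<tau>: "0 \<le> \<tau>" "\<tau> \<le> t" "k * \<tau> = c 0" using False k c0 by (auto simp: \<tau>_def field_simps)
    have "c t - c \<tau> \<le> 0 * (t - \<tau>)"
      by (rule has_integral_le_off_negligible[OF int _ N]) (use \<tau> t bounds in auto)
    moreover have "c \<tau> \<le> 0" using upper[of \<tau>] \<tau> t by auto
    ultimately show ?thesis using nonneg[OF t] False t by (simp add: served_def)
  qed
qed

section \<open>Evolutions started from a perturbed equilibrium\<close>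

context
  fixes r p T :: "'n::finite \<Rightarrow> 'n \<Rightarrow> real" and mu :: "'n \<Rightarrow> real" and x :: "real \<Rightarrow> 'n state"
    and e :: "'n state"
  assumes shares: "destination_shares r p"
    and service: "\<And>i. out_rate r i < mu i"
    and travel_time: "\<And>i j. 0 \<le> T i j"
    and balance: "\<And>i. out_rate r i = (\<Sum>j\<in>UNIV. r j i)"
    and evolution: "evolution r mu p T x"
    and history: "\<And>\<tau>. \<tau> \<in> {- max_delay T..<0} \<Longrightarrow> x \<tau> = e"
    and e: "\<And>i. fst e $ i = 0" "\<And>i. 0 < snd e $ i"
    and queue: "\<And>i. 0 < fst (x 0) $ i"
begin

abbreviation served_customers :: "'n \<Rightarrow> real \<Rightarrow> real" where
  "served_customers i \<equiv> served (fst (x 0) $ i) (mu i - out_rate r i)"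

lemma history_delayed:
  assumes "0 \<le> t" "t < T j i"
  shows "x (t - T j i) = e"
proof -
  have "T j i \<in> range (\<lambda>(i, j). T i j)" by (auto simp: image_iff)
  then have "T j i \<le> max_delay T" unfolding max_delay_def by (intro Max_ge) auto
  then show ?thesis using assms by (intro history) auto
qed

text \<open>Positivity is assumed only before \<open>s\<close>, yet the formulas include time
  \<open>s\<close> itself. This is what allows a contradiction at the first time a vehicle count
  vanishes.\<close>

lemma evolution_while_positive:
  assumes pos: "\<And>t i. 0 \<le> t \<Longrightarrow> t < s \<Longrightarrow> 0 < snd (x t) $ i" and t: "t \<in> {0..s}"
  shows "fst (x t) $ i = fst (x 0) $ i - served_customers i t"
    and "snd (x t) $ i = snd (x 0) $ i - served_customers i t
           + (\<Sum>j\<in>UNIV. p j i * served_customers j (t - T j i))"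
proof -
  obtain w where w: "\<And>t. 0 \<le> t \<Longrightarrow> w absolutely_integrable_on {0..t}"
      "\<And>t. 0 \<le> t \<Longrightarrow> x t = x 0 + integral {0..t} w"
    and ae: "AE t in lebesgue. 0 \<le> t \<longrightarrow> w t \<in> filippov_set (fluid_field r mu p T x t) (x t)"
    using evolution unfolding evolution_def filippov_solution_def by blast
  obtain N where "N \<in> null_sets lebesgue"
      "{t. \<not> (0 \<le> t \<longrightarrow> w t \<in> filippov_set (fluid_field r mu p T x t) (x t))} \<subseteq> N"
    using ae unfolding eventually_ae_filter by auto
  \<comment> \<open>Vehicle counts need not be positive at \<open>s\<close>, so this single time is
    put into the null set.\<close>
  define N' where "N' = insert s N"
  have N': "negligible N'"
    unfolding N'_def using \<open>N \<in> _\<close> by (simp add: negligible_iff_null_sets negligible_insert)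
  have fil: "w t \<in> filippov_set (fluid_field r mu p T x t) (x t)" and pos': "0 < snd (x t) $ i"
    if "t \<in> {0..s} - N'" for t i
    using that \<open>_ \<subseteq> N\<close> pos unfolding N'_def by auto
  have int: "(w has_integral x b - x a) {a..b}" if "0 \<le> a" "a \<le> b" for a b
  proof -
    have "w integrable_on {0..b}" using w(1)[of b] that set_lebesgue_integral_eq_integral(1) by auto
    then have "(w has_integral integral {a..b} w) {a..b}" "integral {0..a} w + integral {a..b} w = integral {0..b} w"
      using that by (auto intro!: integrable_integral integrable_on_subinterval[of w "{0..b}"]
          Henstock_Kurzweil_Integration.integral_combine)
    moreover have "x b - x a = integral {0..b} w - integral {0..a} w"
      using w(2)[of a] w(2)[of b] that by simp
    ultimately show ?thesis by (metis add_diff_cancel_left')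
  qed
  have int_fst: "((\<lambda>t. fst (w t) $ i) has_integral fst (x b) $ i - fst (x a) $ i) {a..b}"
    if "0 \<le> a" "a \<le> b" for a b i
    using has_integral_linear[OF int[OF that], of "\<lambda>z. fst z $ i"]
    by (simp add: o_def bounded_linear_compose[OF bounded_linear_vec_nth bounded_linear_fst])
  have int_snd: "((\<lambda>t. snd (w t) $ i) has_integral snd (x b) $ i - snd (x a) $ i) {a..b}"
    if "0 \<le> a" "a \<le> b" for a b i
    using has_integral_linear[OF int[OF that], of "\<lambda>z. snd z $ i"]
    by (simp add: o_def bounded_linear_compose[OF bounded_linear_vec_nth bounded_linear_snd])
  have fst_eq: "fst (x t) $ i = fst (x 0) $ i - served_customers i t" if "t \<in> {0..s}" for t i
  proof (rule queue_served[of _ "\<lambda>t. fst (x t) $ i" s "\<lambda>t. fst (w t) $ i" N'])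
    show "0 \<le> fst (x t) $ i" if "t \<in> {0..s}" for t
      using evolution that by (auto simp: evolution_def)
    show "((\<lambda>t. fst (w t) $ i) has_integral fst (x b) $ i - fst (x a) $ i) {a..b}"
      if "0 \<le> a" "a \<le> b" for a b
      using that by (rule int_fst)
    fix \<sigma> assume \<sigma>: "\<sigma> \<in> {0..s} - N'"
    note field = filippov_fluid_field[OF shares service fil[OF \<sigma>] pos'[OF \<sigma>], of i]
    show "fst (w \<sigma>) $ i \<in> {- (mu i - out_rate r i)..0}"
      by (rule field(1))
    show "fst (w \<sigma>) $ i = - (mu i - out_rate r i)" if "0 < fst (x \<sigma>) $ i"
      using that by (rule field(2))
  qed (use that service[of i] queue N' in simp_all)
  then show "fst (x t) $ i = fst (x 0) $ i - served_customers i t" using t .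
  \<comment> \<open>\<open>h j\<close> is the flow from \<open>j\<close> into \<open>i\<close> in
    excess of the constant rate \<open>r j i\<close>. For zero travel time it is given by the
    derivative \<open>w\<close>, for positive travel time by the explicit service profile of the
    queue at \<open>j\<close>.\<close>
  define h where "h j \<sigma> = (if T j i = 0 then - p j i * fst (w \<sigma>) $ j
      else p j i * (if 0 \<le> \<sigma> - T j i \<and> \<sigma> - T j i < fst (x 0) $ j / (mu j - out_rate r j)
        then mu j - out_rate r j else 0))" for j \<sigma>
  have h_int: "(h j has_integral p j i * served_customers j (t - T j i)) {0..t}" for j
  proof (cases "T j i = 0")
    case True
    have "((\<lambda>\<sigma>. - p j i * fst (w \<sigma>) $ j) has_integral - p j i * (fst (x t) $ j - fst (x 0) $ j)) {0..t}"
      using t by (intro has_integral_mult_right int_fst) auto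
    then show ?thesis using True fst_eq[OF t, of j] by (simp add: h_def[abs_def])
  next
    case False
    then show ?thesis
      unfolding h_def[abs_def] using t service[of j] queue travel_time
      by (simp only: if_False) (intro has_integral_mult_right served_has_integral; simp)
  qed
  have arrival: "arrival_rate r mu p (x (\<sigma> - T j i)) j i = r j i + h j \<sigma>"
    if "\<sigma> \<in> {0..s}" "T j i \<noteq> 0" for \<sigma> j
  proof (cases "\<sigma> < T j i")
    \<comment> \<open>The vehicles arriving now left during the history, when all queues were empty,
      so there is no excess flow.\<close>
    case True
    then show ?thesis
      using that history_delayed[of \<sigma> j i] e
      by (simp add: h_def arrival_rate_eq[OF shares service] heaviside_def)
  next
    case False
    let ?\<rho> = "\<sigma> - T j i"
    \<comment> \<open>The positive travel time makes the departure time strictly smaller than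
      \<open>s\<close>, where positivity of the vehicle counts is available.\<close>
    have \<rho>: "0 \<le> ?\<rho>" "?\<rho> < s" using False that travel_time[of j i] by auto
    have "heaviside (fst (x ?\<rho>) $ j) = (if ?\<rho> < fst (x 0) $ j / (mu j - out_rate r j) then 1 else 0)"
      using fst_eq[of ?\<rho> j] \<rho> served_less_iff[of "mu j - out_rate r j" ?\<rho> "fst (x 0) $ j"] service[of j]
      by (simp add: heaviside_def)
    then show ?thesis
      using that False arrival_rate_eq[OF shares service pos[OF \<rho>]] by (simp add: h_def)
  qed
  have "((\<lambda>\<sigma>. fst (w \<sigma>) $ i + (\<Sum>j\<in>UNIV. h j \<sigma>)) has_integral
      (fst (x t) $ i - fst (x 0) $ i) + (\<Sum>j\<in>UNIV. p j i * served_customers j (t - T j i))) {0..t}"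
    using t by (intro has_integral_add int_fst has_integral_sum h_int) auto
  moreover have "snd (w \<sigma>) $ i = fst (w \<sigma>) $ i + (\<Sum>j\<in>UNIV. h j \<sigma>)" if "\<sigma> \<in> {0..t} - N'" for \<sigma>
  proof -
    have \<sigma>: "\<sigma> \<in> {0..s} - N'" using that t by auto
    have "(\<Sum>j\<in>UNIV. if T j i = 0 then r j i - p j i * fst (w \<sigma>) $ j
                      else arrival_rate r mu p (x (\<sigma> - T j i)) j i) = (\<Sum>j\<in>UNIV. r j i + h j \<sigma>)"
      using \<sigma> arrival by (intro sum.cong) (auto simp: h_def)
    then show ?thesis
      using filippov_fluid_field(3)[OF shares service fil[OF \<sigma>] pos'[OF \<sigma>], of i] balance[of i]
      by (simp add: sum.distrib)
  qed
  ultimately have "((\<lambda>\<sigma>. snd (w \<sigma>) $ i) has_integral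
      (fst (x t) $ i - fst (x 0) $ i) + (\<Sum>j\<in>UNIV. p j i * served_customers j (t - T j i))) {0..t}"
    by (rule has_integral_spike[OF N', rotated])
  then have "(fst (x t) $ i - fst (x 0) $ i) + (\<Sum>j\<in>UNIV. p j i * served_customers j (t - T j i))
      = snd (x t) $ i - snd (x 0) $ i"
    by (rule has_integral_unique[OF _ int_snd]) (use t in auto)
  then show "snd (x t) $ i = snd (x 0) $ i - served_customers i t
           + (\<Sum>j\<in>UNIV. p j i * served_customers j (t - T j i))"
    using fst_eq[OF t, of i] by simp
qed

text \<open>At the first time \<open>s\<close> at which some count vanishes, attained since
  \<open>Z\<close> is closed, the explicit formula still holds. Region \<open>j\<close> has then
  lost at most its initial queue, which is smaller than its initial count, and the excess arrivals
  are nonnegative.\<close>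

lemma vehicles_remain:
  assumes small: "\<And>i. fst (x 0) $ i < snd (x 0) $ i" and "0 \<le> t"
  shows "0 < snd (x t) $ i"
proof (rule ccontr)
  assume contra: "\<not> 0 < snd (x t) $ i"
  define Z where "Z = (\<Union>i. {t \<in> {0..}. snd (x t) $ i \<le> 0})"
  have "continuous_on {0..} x" using evolution by (simp add: evolution_def)
  then have "closed Z"
    unfolding Z_def
    by (intro closed_UN finite_UNIV ballI continuous_on_closed_Collect_le continuous_intros closed_atLeast) auto
  moreover have "Z \<noteq> {}" using contra \<open>0 \<le> t\<close> by (auto simp: Z_def not_less)
  moreover have bdd: "bdd_below Z" by (auto simp: Z_def intro!: bdd_belowI[where m = 0])
  ultimately have "Inf Z \<in> Z" by (intro closed_contains_Inf)
  define s where "s = Inf Z"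
  obtain j where j: "0 \<le> s" "snd (x s) $ j \<le> 0" using \<open>Inf Z \<in> Z\<close> by (auto simp: Z_def s_def)
  have pos: "0 < snd (x t) $ i" if "0 \<le> t" "t < s" for t i
  proof (rule ccontr)
    assume "\<not> 0 < snd (x t) $ i"
    then have "t \<in> Z" using that by (auto simp: Z_def not_less)
    then show False using cInf_lower[OF _ bdd, of t] that by (simp add: s_def)
  qed
  have "0 \<le> served_customers i u" "served_customers i u \<le> fst (x 0) $ i" for i u
    using served_bounds service[of i] queue[of i] by (simp_all add: less_imp_le)
  moreover from this have "0 \<le> (\<Sum>k\<in>UNIV. p k j * served_customers k (s - T k j))"
    by (intro sum_nonneg mult_nonneg_nonneg share_nonneg[OF shares service])
  ultimately show False
    using evolution_while_positive(2)[of s s j] pos j small[of j] by (smt (verit) atLeastAtMost_iff)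
qed

text \<open>Once every queue is exhausted and the longest subsequent trip is over, all served
  amounts, delayed or not, equal the initial queues. Finitely many regions give a common
  threshold.\<close>

lemma evolution_eventually_constant:
  assumes small: "\<And>i. fst (x 0) $ i < snd (x 0) $ i"
  shows "\<forall>\<^sub>F t in at_top.
    x t = (0, \<chi> i. snd (x 0) $ i - fst (x 0) $ i + (\<Sum>j\<in>UNIV. p j i * fst (x 0) $ j))"
proof -
  define \<tau> where "\<tau> i = fst (x 0) $ i / (mu i - out_rate r i)" for i
  have "\<forall>\<^sub>F t in at_top. \<forall>j i. t - T j i \<ge> \<tau> j"
    by (intro eventually_all_finite) (auto simp: le_diff_eq intro: eventually_ge_at_top)
  moreover have "\<forall>\<^sub>F t in at_top. \<forall>i. t \<ge> \<tau> i"
    by (intro eventually_all_finite) (auto intro: eventually_ge_at_top)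
  ultimately show ?thesis
    using eventually_ge_at_top[of 0]
  proof eventually_elim
    case (elim t)
    have "served_customers j (t - T j i) = fst (x 0) $ j" "served_customers j t = fst (x 0) $ j" for j i
      using elim service[of j] queue[of j] by (auto intro!: served_eventually simp: \<tau>_def less_imp_le)
    \<comment> \<open>Since no vehicle count ever vanishes, the formulas are available with
      \<open>s = t\<close> for every \<open>t\<close>.\<close>
    then have "fst (x t) $ i = 0"
      "snd (x t) $ i = snd (x 0) $ i - fst (x 0) $ i + (\<Sum>j\<in>UNIV. p j i * fst (x 0) $ j)" for i
      using evolution_while_positive[of t t i] vehicles_remain[OF small] elim(3) by simp_all
    then show ?case by (simp add: prod_eq_iff vec_eq_iff)
  qed
qed

end

section \<open>Comparison of norms and local stability\<close>

text \<open>One half of the equivalence of norms in finite dimension: \<open>nrm\<close> is convex,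
  hence continuous, and its minimum \<open>l\<close> over the compact unit sphere is positive;
  scaling gives \<open>l * norm z \<le> nrm z\<close>.\<close>

lemma is_norm_controls_norm:
  fixes nrm :: "'a::euclidean_space \<Rightarrow> real"
  assumes nrm: "is_norm nrm" and "0 < \<epsilon>"
  obtains \<delta> where "0 < \<delta>" "\<And>z. nrm z < \<delta> \<Longrightarrow> norm z < \<epsilon>"
proof -
  have zero: "nrm z = 0 \<longleftrightarrow> z = 0" and tri: "nrm (y + z) \<le> nrm y + nrm z"
    and scale: "nrm (a *\<^sub>R z) = \<bar>a\<bar> * nrm z" for y z a
    using nrm by (auto simp: is_norm_def)
  have nonneg: "0 \<le> nrm z" for z
    using tri[of z "- z"] scale[of "-1" z] zero[of 0] by simp
  have "convex_on UNIV nrm"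
    by (intro convex_onI) (auto intro!: order_trans[OF tri] simp: scale)
  then have "continuous_on UNIV nrm" by (intro convex_on_continuous) auto
  then have cont: "continuous_on (sphere 0 1) nrm" by (rule continuous_on_subset) auto
  obtain l where l: "0 < l" "\<And>z. norm z = 1 \<Longrightarrow> l \<le> nrm z"
  proof -
    obtain z0 where "z0 \<in> sphere 0 1" "\<forall>z\<in>sphere 0 1. nrm z0 \<le> nrm z"
      using continuous_attains_inf[OF compact_sphere _ cont] by auto
    moreover from this have "nrm z0 \<noteq> 0" by (auto simp: zero)
    ultimately show ?thesis using nonneg[of z0] by (intro that[of "nrm z0"]) auto
  qed
  have "l * norm z \<le> nrm z" for z
  proof (cases "z = 0")
    case False
    then have "l \<le> nrm ((1 / norm z) *\<^sub>R z)" by (intro l) simp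
    then show ?thesis using False by (simp add: scale field_simps)
  qed (simp add: nonneg)
  then show ?thesis
    using l(1) \<open>0 < \<epsilon>\<close> by (intro that[of "l * \<epsilon>"]) (simp, metis le_less_trans mult_less_cancel_left_pos)
qed

theorem theorem2:
  fixes lam :: "'n::finite \<Rightarrow> 'n \<Rightarrow> real \<Rightarrow> real"
    and T umax u r p :: "'n \<Rightarrow> 'n \<Rightarrow> real"
    and mu :: "'n \<Rightarrow> real"
    and nrm :: "'n state \<Rightarrow> real"
    and m :: real
  assumes travel_time: "\<And>i j. 0 \<le> T i j"
    and demand_nonneg: "\<And>i j w. 0 \<le> w \<Longrightarrow> 0 \<le> lam i j w"
    and demand_decreasing: "\<And>i j. antimono_on {0..} (lam i j)"
    and demand_umax: "\<And>i j. lam i j (umax i j) = 0"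
    and price: "\<And>i j. u i j \<in> {1..umax i j}"
    and service: "\<And>i. mu i > (\<Sum>j\<in>UNIV. lam i j 1)"
    and rate: "\<And>i j. r i j = lam i j (u i j)"
    and shares: "destination_shares r p"
    and nrm: "is_norm nrm"
    and balance: "\<And>i. (\<Sum>j\<in>UNIV. lam i j (u i j) - lam j i (u j i)) = 0"
    and fleet: "m > in_transit T r"
  shows "\<forall>e \<in> equilibria T r m. \<exists>\<delta>>0. \<forall>x.
           evolution r mu p T x \<and> (\<forall>\<tau>\<in>{- max_delay T..<0}. x \<tau> = e) \<and> x 0 \<in> perturbations nrm \<delta> e
           \<longrightarrow> (\<exists>y \<in> equilibria T r m. (x \<longlongrightarrow> y) at_top)"
proof
  fix e assume "e \<in> equilibria T r m"
  then have e: "\<And>i. fst e $ i = 0" "\<And>i. 0 < snd e $ i"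
    and total: "(\<Sum>i\<in>UNIV. snd e $ i) = m - in_transit T r"
    by (auto simp: equilibria_def)
  have service': "out_rate r i < mu i" for i
  proof -
    have "lam i j (u i j) \<le> lam i j 1" for j
      using monotone_onD[OF demand_decreasing[of i j], of 1 "u i j"] price[of i j] by simp
    then have "out_rate r i \<le> (\<Sum>j\<in>UNIV. lam i j 1)"
      unfolding out_rate_def rate by (rule sum_mono)
    then show ?thesis using service[of i] by simp
  qed
  have balance': "out_rate r i = (\<Sum>j\<in>UNIV. r j i)" for i
    using balance[of i] by (simp add: out_rate_def rate sum_subtractf)
  \<comment> \<open>A queue vector of Euclidean norm below the smallest vehicle count has every
    component below the count of its region, as \<open>vehicles_remain\<close> requires.\<close>
  define \<epsilon> where "\<epsilon> = Min (range (\<lambda>i. snd e $ i))"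
  have "0 < \<epsilon>" and \<epsilon>: "\<epsilon> \<le> snd e $ i" for i
    using e(2) by (auto simp: \<epsilon>_def)
  obtain \<delta> where \<delta>: "0 < \<delta>" "\<And>z. nrm z < \<delta> \<Longrightarrow> norm z < \<epsilon>"
    by (rule is_norm_controls_norm[OF nrm \<open>0 < \<epsilon>\<close>]) (rule that)
  show "\<exists>\<delta>>0. \<forall>x.
      evolution r mu p T x \<and> (\<forall>\<tau>\<in>{- max_delay T..<0}. x \<tau> = e) \<and> x 0 \<in> perturbations nrm \<delta> e
      \<longrightarrow> (\<exists>y \<in> equilibria T r m. (x \<longlongrightarrow> y) at_top)"
  proof (intro exI[of _ \<delta>] conjI \<delta>(1) allI impI)
    fix x assume x: "evolution r mu p T x \<and> (\<forall>\<tau>\<in>{- max_delay T..<0}. x \<tau> = e) \<and> x 0 \<in> perturbations nrm \<delta> e"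
    then have evolution: "evolution r mu p T x" and history: "\<And>\<tau>. \<tau> \<in> {- max_delay T..<0} \<Longrightarrow> x \<tau> = e"
      and "x 0 \<in> perturbations nrm \<delta> e"
      by blast+
    from this(3) have queue: "\<And>i. 0 < fst (x 0) $ i" and v0: "snd (x 0) = snd e"
      and close: "nrm (fst (x 0) - fst e, 0) < \<delta>"
      by (auto simp: perturbations_def vec_eq_iff)
    have "fst e = 0" using e(1) by (simp add: vec_eq_iff)
    then have "norm (fst (x 0)) < \<epsilon>" using \<delta>(2)[OF close] by (simp add: norm_Pair)
    then have small: "fst (x 0) $ i < snd (x 0) $ i" for i
      using component_le_norm_cart[of "fst (x 0)" i] \<epsilon>[of i] v0 by simp
    define y where "y = (0 :: real ^ 'n,
      \<chi> i. snd (x 0) $ i - fst (x 0) $ i + (\<Sum>j\<in>UNIV. p j i * fst (x 0) $ j))"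
    have "\<forall>\<^sub>F t in at_top. x t = y"
      unfolding y_def
      by (rule evolution_eventually_constant[OF shares service' travel_time balance' evolution history e queue])
         (auto intro: small)
    then have "(x \<longlongrightarrow> y) at_top" by (rule tendsto_eventually)
    moreover have "y \<in> equilibria T r m"
    proof -
      have "0 < snd y $ i" for i
      proof -
        have "0 \<le> (\<Sum>j\<in>UNIV. p j i * fst (x 0) $ j)"
          using queue by (intro sum_nonneg mult_nonneg_nonneg share_nonneg[OF shares service']) (simp add: less_imp_le)
        then show ?thesis using small[of i] by (simp add: y_def)
      qed
      \<comment> \<open>The vehicles that serve the initial queues all reappear at their
        destinations because the shares of each origin sum to 1, so the total stays that of
        \<open>e\<close>.\<close>
      moreover have "(\<Sum>i\<in>UNIV. \<Sum>j\<in>UNIV. p j i * fst (x 0) $ j) = (\<Sum>j\<in>UNIV. fst (x 0) $ j)"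
        by (subst sum.swap) (simp add: sum_distrib_right[symmetric] share_sum[OF shares service'])
      then have "(\<Sum>i\<in>UNIV. snd y $ i) = m - in_transit T r"
        using total v0 by (simp add: y_def sum.distrib sum_subtractf)
      ultimately show ?thesis by (simp add: equilibria_def y_def)
    qed
    ultimately show "\<exists>y \<in> equilibria T r m. (x \<longlongrightarrow> y) at_top" by blast
  qed
qed

end
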